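(* For all integers $n\ge1$ and $s\ge0$, $k_1((n+2)s,n)\ge k_2(s,n)$.
   Context: Bounded convex polyhedra in $n$-dimensional space are allowed to be degenerate (to have empty interior); boundary and interior are always taken in the ambient $n$-dimensional space. Two polyhedra $P$ and $Q$ are separated if there is a hyperplane $\pi$ such that $P$ and $Q$ lie in different closed halfspaces with respect to $\pi$. Given a finite set $S$ of points in $n$-dimensional space ($S\subseteq\mathbb{Q}^n$), a double covering (respectively single covering) of $S$ of size $k$ is a family $P_1,\dots,P_k$ of bounded convex polyhedra that are pairwise separated and such that each point of $S$ lies on the boundary of at least two (respectively at least one) of the polyhedra $P_i$. $k_2(s,n)$ (respectively $k_1(s,n)$) is the minimal number of polyhedra that is enough to double cover (respectively single cover) any $s$ points in $n$-dimensional space. *)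

theory Defs
  imports "HOL-Analysis.Analysis"
begin

definition separated :: "('a::euclidean_space) set \<Rightarrow> 'a set \<Rightarrow> bool" where
  "separated P Q \<longleftrightarrow>
     (\<exists>a b. a \<noteq> 0 \<and> P \<subseteq> {x. a \<bullet> x \<le> b} \<and> Q \<subseteq> {x. a \<bullet> x \<ge> b})"

definition rational_points :: "(real ^ 'n::finite) set" where
  "rational_points = {x. \<forall>i. x $ i \<in> \<rat>}"

text \<open>
  A single covering is an \<open>m\<close>-fold covering with \<open>m = 1\<close>, a double covering one with \<open>m = 2\<close>.
  The polyhedra form an indexed family: a (degenerate) polyhedron may occur
  twice in it and is then counted twice.
\<close>

definition fold_covering ::
  "nat \<Rightarrow> (real ^ 'n::finite) set \<Rightarrow> nat \<Rightarrow> (nat \<Rightarrow> (real ^ 'n) set) \<Rightarrow> bool" where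
  "fold_covering m S k P \<longleftrightarrow>
     (\<forall>i<k. polyhedron (P i) \<and> bounded (P i)) \<and>
     (\<forall>i<k. \<forall>j<k. i \<noteq> j \<longrightarrow> separated (P i) (P j)) \<and>
     (\<forall>x\<in>S. card {i. i < k \<and> x \<in> frontier (P i)} \<ge> m)"

abbreviation single_covering ::
  "(real ^ 'n::finite) set \<Rightarrow> nat \<Rightarrow> (nat \<Rightarrow> (real ^ 'n) set) \<Rightarrow> bool" where
  "single_covering \<equiv> fold_covering 1"

abbreviation double_covering ::
  "(real ^ 'n::finite) set \<Rightarrow> nat \<Rightarrow> (nat \<Rightarrow> (real ^ 'n) set) \<Rightarrow> bool" where
  "double_covering \<equiv> fold_covering 2"

text \<open>
  The dimension is \<open>CARD('n)\<close>, passed as a type argument.  The minimum exists, as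
  lemma \<open>covering_size_exists\<close> below shows.
\<close>

definition k1 :: "nat \<Rightarrow> 'n::finite itself \<Rightarrow> nat" where
  "k1 s _ = (LEAST k. \<forall>S :: (real ^ 'n) set.
     S \<subseteq> rational_points \<and> finite S \<and> card S = s \<longrightarrow> (\<exists>P. single_covering S k P))"

definition k2 :: "nat \<Rightarrow> 'n::finite itself \<Rightarrow> nat" where
  "k2 s _ = (LEAST k. \<forall>S :: (real ^ 'n) set.
     S \<subseteq> rational_points \<and> finite S \<and> card S = s \<longrightarrow> (\<exists>P. double_covering S k P))"

lemma separated_singletons: "separated {x} {y}" for x y :: "'a::euclidean_space"
proof (cases "x = y")
  case True
  obtain a :: 'a where "a \<in> Basis" using nonempty_Basis by blast
  then have "a \<noteq> 0" by auto
  then show ?thesis unfolding separated_def using True by (intro exI[of _ a] exI[of _ "a \<bullet> y"]) auto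
next
  case False
  have "(y - x) \<bullet> (y - x) \<ge> 0" by simp
  then have "(y - x) \<bullet> x \<le> (y - x) \<bullet> y" by (simp add: inner_diff_right)
  then show ?thesis unfolding separated_def using False
    by (intro exI[of _ "y - x"] exI[of _ "(y - x) \<bullet> y"]) auto
qed

lemma covering_size_exists:
  "\<exists>k. \<forall>S :: (real ^ 'n::finite) set.
     S \<subseteq> rational_points \<and> finite S \<and> card S = s \<longrightarrow> (\<exists>P. fold_covering m S k P)"
proof (intro exI[of _ "m * s"] allI impI)
  fix S :: "(real ^ 'n) set"
  assume S: "S \<subseteq> rational_points \<and> finite S \<and> card S = s"
  then obtain f where f: "bij_betw f {..<s} S"
    using ex_bij_betw_nat_finite[of S] by (auto simp: atLeast0LessThan)
  define P where "P = (\<lambda>i. {f (i mod s)})"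
  have "card {i. i < m * s \<and> x \<in> frontier (P i)} \<ge> m" if "x \<in> S" for x
  proof -
    from that f obtain j where j: "j < s" "f j = x" by (auto simp: bij_betw_def)
    have lt: "a * s + j < m * s" if "a < m" for a
    proof -
      have "a * s + j < Suc a * s" using j by simp
      also have "\<dots> \<le> m * s" using that by (intro mult_le_mono1) simp
      finally show ?thesis .
    qed
    have "inj_on (\<lambda>a. a * s + j) {..<m}" using j by (auto simp: inj_on_def)
    then have "m = card ((\<lambda>a. a * s + j) ` {..<m})" by (simp add: card_image)
    also have "\<dots> \<le> card {i. i < m * s \<and> x \<in> frontier (P i)}"
      using j lt by (intro card_mono) (auto simp: P_def frontier_def)
    finally show ?thesis .
  qed
  moreover have "polyhedron (P i)" for i
    unfolding P_def using polytope_convex_hull[of "{f (i mod s)}"]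
    by (simp add: polytope_imp_polyhedron)
  ultimately have "fold_covering m S (m * s) P"
    unfolding fold_covering_def
    by (auto simp: P_def separated_singletons)
  then show "\<exists>P. fold_covering m S (m * s) P" by blast
qed

end

theory Submission
  imports Defs
begin

text \<open>
  Let \<open>k = k1 ((n + 2) * s)\<close> and let \<open>S\<close> be a set of \<open>s\<close> rational points.  Every point \<open>x\<close>
  of \<open>S\<close> is blown up to a tiny cluster of \<open>n + 2\<close> points: \<open>x\<close> itself and the vertices of a simplex
  around \<open>x\<close>.  Some \<open>k\<close> pairwise separated polyhedra \<open>P\<^sub>i\<close> cover all the cluster points by their
  boundaries.  No single \<open>P\<^sub>i\<close> can have a whole cluster on its boundary: being convex, it would
  contain the simplex, and the centre of the cluster would be an interior point
  (\<open>frontier_avoids_cluster_point\<close>).  Hence every cluster meets the boundaries of at least two of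
  the polyhedra.

  Now the clusters are contracted.  Let \<open>T\<^sub>i\<close> be the set of all \<open>x\<close> in \<open>S\<close> whose cluster meets the
  boundary of \<open>P\<^sub>i\<close>.  The convex hulls of the \<open>T\<^sub>i\<close> are polyhedra, and they form the required double
  covering:

  \<^item> They are pairwise separated.  A hyperplane between \<open>P\<^sub>i\<close> and \<open>P\<^sub>j\<close> separates \<open>T\<^sub>i\<close> from \<open>T\<^sub>j\<close> up
    to an error of the order of the cluster radius.  By compactness of the unit sphere, finite sets
    that can be separated up to every positive error can be separated exactly; since \<open>S\<close> has only
    finitely many subsets, one sufficiently small error works for all pairs of subsets of \<open>S\<close>
    (\<open>uniform_separation_error\<close>).  So the cluster radius can be fixed before the \<open>P\<^sub>i\<close> are known.

  \<^item> Every \<open>x\<close> in \<open>S\<close> belongs to two of them, and a common point of two separated sets is on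
    the boundary of both (\<open>separated_Int_subset_frontier\<close>).
\<close>

section \<open>Separation and boundaries\<close>

text \<open>
  An interior point of a closed halfspace is not on the bounding hyperplane, but a common point of
  two separated sets is.
\<close>

lemma separated_Int_subset_frontier:
  fixes P Q :: "'a::euclidean_space set"
  assumes "separated P Q"
  shows "P \<inter> Q \<subseteq> frontier P \<inter> frontier Q"
proof
  fix x assume x: "x \<in> P \<inter> Q"
  from assms obtain a b where a: "a \<noteq> 0"
    and P: "P \<subseteq> {x. a \<bullet> x \<le> b}" and Q: "Q \<subseteq> {x. a \<bullet> x \<ge> b}"
    unfolding separated_def by blast
  have "a \<bullet> x = b" using x P Q by force
  moreover have "interior P \<subseteq> {x. a \<bullet> x < b}"
    using interior_mono[OF P] a by simp
  moreover have "interior Q \<subseteq> {x. a \<bullet> x > b}"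
    using interior_mono[OF Q] a by simp
  ultimately show "x \<in> frontier P \<inter> frontier Q"
    using x closure_subset unfolding frontier_def by fastforce
qed

lemma supporting_hyperplane_frontier:
  fixes P :: "'a::euclidean_space set"
  assumes "convex P" "closed P" "x \<in> frontier P"
  obtains a where "a \<noteq> 0" "\<And>y. y \<in> P \<Longrightarrow> a \<bullet> x \<le> a \<bullet> y"
proof (cases "interior P = {}")
  case True
  then obtain a b where "a \<noteq> 0" and P: "P \<subseteq> {x. a \<bullet> x = b}"
    using empty_interior_subset_hyperplane assms(1) by blast
  moreover have "x \<in> P" using assms by (simp add: frontier_def)
  then have "a \<bullet> x = b" using P by blast
  then have "a \<bullet> x \<le> a \<bullet> y" if "y \<in> P" for y using subsetD[OF P that] by simp
  ultimately show ?thesis using that by blast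
next
  case False
  then have "x \<notin> rel_interior P"
    using assms(3) by (simp add: rel_interior_nonempty_interior frontier_def)
  moreover have "x \<in> P" using assms by (simp add: frontier_def)
  ultimately show ?thesis
    using supporting_hyperplane_rel_boundary[OF assms(1)] that by blast
qed

section \<open>Separation up to a small error\<close>

lemma separated_convex_hulls:
  fixes T U :: "'a::euclidean_space set"
  assumes fin: "finite T" "finite U" and a: "a \<noteq> 0"
    and le: "\<And>x y. x \<in> T \<Longrightarrow> y \<in> U \<Longrightarrow> a \<bullet> x \<le> a \<bullet> y"
  shows "separated (convex hull T) (convex hull U)"
proof -
  have "\<exists>b. (\<forall>x\<in>T. a \<bullet> x \<le> b) \<and> (\<forall>y\<in>U. b \<le> a \<bullet> y)"
  proof (cases "T = {}")
    case False
    then have "Max ((\<bullet>) a ` T) \<in> (\<bullet>) a ` T" using fin by (intro Max_in) auto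
    then show ?thesis using fin le by (intro exI[of _ "Max ((\<bullet>) a ` T)"]) auto
  next
    case True
    have "\<forall>y\<in>U. Min (insert 0 ((\<bullet>) a ` U)) \<le> a \<bullet> y" using fin by auto
    with True show ?thesis by blast
  qed
  then obtain b where "T \<subseteq> {x. a \<bullet> x \<le> b}" "U \<subseteq> {x. a \<bullet> x \<ge> b}" by auto
  then have "convex hull T \<subseteq> {x. a \<bullet> x \<le> b}" "convex hull U \<subseteq> {x. a \<bullet> x \<ge> b}"
    by (simp_all add: hull_minimal convex_halfspace_le convex_halfspace_ge)
  with a show ?thesis unfolding separated_def by blast
qed

definition almost_separates ::
  "real \<Rightarrow> 'a::euclidean_space \<Rightarrow> 'a set \<Rightarrow> 'a set \<Rightarrow> bool" where
  "almost_separates e a T U \<longleftrightarrow> norm a = 1 \<and> (\<forall>x\<in>T. \<forall>y\<in>U. a \<bullet> x \<le> a \<bullet> y + e)"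

lemma almost_separates_mono:
  "almost_separates e a T U \<Longrightarrow> e \<le> e' \<Longrightarrow> almost_separates e' a T U"
  unfolding almost_separates_def by force

text \<open>
  Unit normals for errors tending to 0 have a limit point on the unit sphere, which is a normal
  for the error 0.
\<close>

lemma separated_if_almost_separated:
  fixes T U :: "'a::euclidean_space set"
  assumes fin: "finite T" "finite U"
    and "\<And>e. e > 0 \<Longrightarrow> \<exists>a. almost_separates e a T U"
  shows "separated (convex hull T) (convex hull U)"
proof -
  have "\<forall>m. \<exists>a. almost_separates (inverse (real (Suc m))) a T U"
    using assms(3) by simp
  then obtain f where f: "\<And>m. almost_separates (inverse (real (Suc m))) (f m) T U"
    by metis
  have "\<forall>m. f m \<in> sphere 0 1" using f by (simp add: almost_separates_def)
  then obtain a r where a: "a \<in> sphere 0 1" and r: "strict_mono r" and lim: "(f \<circ> r) \<longlonglongrightarrow> a"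
    using compact_sphere[of "0::'a" 1] unfolding compact_def by metis
  have "a \<bullet> x \<le> a \<bullet> y" if "x \<in> T" "y \<in> U" for x y
  proof -
    have "(\<lambda>m. inverse (real (Suc (r m)))) \<longlonglongrightarrow> 0"
      using LIMSEQ_subseq_LIMSEQ[OF LIMSEQ_inverse_real_of_nat r] by (simp add: o_def)
    then have "(\<lambda>m. (f \<circ> r) m \<bullet> y + inverse (real (Suc (r m)))) \<longlonglongrightarrow> a \<bullet> y + 0"
      by (intro tendsto_intros lim)
    moreover have "(\<lambda>m. (f \<circ> r) m \<bullet> x) \<longlonglongrightarrow> a \<bullet> x"
      by (intro tendsto_intros lim)
    moreover have "(f \<circ> r) m \<bullet> x \<le> (f \<circ> r) m \<bullet> y + inverse (real (Suc (r m)))" for m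
      using f[of "r m"] that by (simp add: almost_separates_def)
    ultimately show ?thesis
      using LIMSEQ_le[of "\<lambda>m. (f \<circ> r) m \<bullet> x"] by fastforce
  qed
  moreover have "a \<noteq> 0" using a by auto
  ultimately show ?thesis using separated_convex_hulls fin by blast
qed

text \<open>
  Each of the finitely many pairs of subsets whose hulls are not separated excludes all errors
  below some positive bound; the least of these bounds works for all pairs.
\<close>

lemma uniform_separation_error:
  fixes S :: "'a::euclidean_space set"
  assumes "finite S"
  obtains e where "e > 0"
    "\<And>T U a. T \<subseteq> S \<Longrightarrow> U \<subseteq> S \<Longrightarrow> almost_separates e a T U \<Longrightarrow>
       separated (convex hull T) (convex hull U)"
proof -
  have "\<exists>e>0. (\<exists>a. almost_separates e a T U) \<longrightarrow> separated (convex hull T) (convex hull U)"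
    if "T \<subseteq> S" "U \<subseteq> S" for T U
    using separated_if_almost_separated[of T U] that finite_subset[OF _ assms]
    by (meson zero_less_one)
  then obtain g where g: "\<And>T U. T \<subseteq> S \<Longrightarrow> U \<subseteq> S \<Longrightarrow> g T U > 0 \<and>
      ((\<exists>a. almost_separates (g T U) a T U) \<longrightarrow> separated (convex hull T) (convex hull U))"
    by metis
  define E where "E = insert 1 (case_prod g ` (Pow S \<times> Pow S))"
  have E: "finite E" "E \<noteq> {}" using assms by (auto simp: E_def)
  show ?thesis
  proof
    show "Min E > 0" using E g by (auto simp: E_def)
    fix T U a assume TU: "T \<subseteq> S" "U \<subseteq> S" and sep: "almost_separates (Min E) a T U"
    have "g T U \<in> E" using TU by (auto simp: E_def)
    then have "Min E \<le> g T U" using E by simp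
    then show "separated (convex hull T) (convex hull U)"
      using almost_separates_mono[OF sep] g[OF TU] by blast
  qed
qed

section \<open>Clusters\<close>

text \<open>
  The centre and the vertices of a simplex with the origin in its interior.  Its vertices are
  rational, which a regular simplex could not offer in every dimension.
\<close>

definition cluster :: "'a::euclidean_space set" where
  "cluster = insert 0 (insert (- \<Sum>Basis) Basis)"

lemma zero_in_cluster: "0 \<in> cluster"
  by (simp add: cluster_def)

lemma finite_cluster: "finite cluster"
  by (simp add: cluster_def)

lemma inner_neg_sum_Basis: "b \<in> Basis \<Longrightarrow> (- \<Sum>Basis) \<bullet> b = -1"
  by (simp add: inner_sum_left inner_Basis if_distrib cong: if_cong)

lemma card_cluster: "card (cluster :: 'a::euclidean_space set) = DIM('a) + 2"
proof -
  have neg: "(- \<Sum>Basis :: 'a) \<notin> Basis"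
  proof
    assume *: "(- \<Sum>Basis :: 'a) \<in> Basis"
    then have "(- \<Sum>Basis :: 'a) \<bullet> (- \<Sum>Basis) = -1" by (rule inner_neg_sum_Basis)
    moreover have "(- \<Sum>Basis :: 'a) \<bullet> (- \<Sum>Basis) \<ge> 0" by (rule inner_ge_zero)
    ultimately show False by linarith
  qed
  obtain b :: 'a where "b \<in> Basis" using nonempty_Basis by blast
  then have "(- \<Sum>Basis :: 'a) \<noteq> 0" using inner_neg_sum_Basis[of b] by force
  moreover have "(0::'a) \<notin> Basis" by simp
  ultimately show ?thesis using neg by (simp add: cluster_def)
qed

lemma cluster_rational: "(cluster :: (real ^ 'n::finite) set) \<subseteq> rational_points"
proof -
  have "(b :: real ^ 'n) \<in> rational_points" if "b \<in> Basis" for b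
    using that by (auto simp: rational_points_def Basis_vec_def axis_def)
  then show ?thesis
    by (auto simp: cluster_def rational_points_def intro!: Rats_sum)
qed

text \<open>
  A supporting hyperplane at the centre would have a normal whose inner products with all the
  basis vectors and with the negative of their sum are nonnegative, and hence zero.
\<close>

lemma frontier_avoids_cluster_point:
  fixes P :: "'a::euclidean_space set"
  assumes "convex P" "closed P" "x \<in> frontier P" "d > 0"
  shows "\<exists>v\<in>cluster. x + d *\<^sub>R v \<notin> P"
proof (rule ccontr)
  assume "\<not> ?thesis"
  then have P: "x + d *\<^sub>R v \<in> P" if "v \<in> cluster" for v using that by blast
  obtain a where a: "a \<noteq> 0" and sup: "\<And>y. y \<in> P \<Longrightarrow> a \<bullet> x \<le> a \<bullet> y"
    using supporting_hyperplane_frontier assms(1-3) by blast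
  have pos: "0 \<le> a \<bullet> v" if "v \<in> cluster" for v
    using sup[OF P[OF that]] assms(4) by (simp add: inner_add_right zero_le_mult_iff)
  have nonneg: "0 \<le> a \<bullet> b" if "b \<in> Basis" for b
    using pos that by (simp add: cluster_def)
  have "(\<Sum>b\<in>Basis. a \<bullet> b) \<le> 0"
    using pos[of "- \<Sum>Basis"] by (simp add: cluster_def inner_sum_right)
  then have "(\<Sum>b\<in>Basis. a \<bullet> b) = 0" using nonneg by (simp add: antisym sum_nonneg)
  then have "\<forall>b\<in>Basis. a \<bullet> b = 0" using nonneg by (simp add: sum_nonneg_eq_0_iff)
  then show False using a euclidean_all_zero_iff by blast
qed

lemma inj_on_small_translates:
  fixes S V :: "'a::euclidean_space set"
  assumes sep: "\<And>x y. x \<in> S \<Longrightarrow> y \<in> S \<Longrightarrow> dist x y < r \<Longrightarrow> x = y"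
    and V: "\<And>v. v \<in> V \<Longrightarrow> norm v \<le> M" and d: "d > 0" "2 * M * d < r"
  shows "inj_on (\<lambda>(x, v). x + d *\<^sub>R v) (S \<times> V)"
proof -
  have "x = y \<and> v = w"
    if in_sets: "x \<in> S" "y \<in> S" "v \<in> V" "w \<in> V" and eq: "x + d *\<^sub>R v = y + d *\<^sub>R w" for x y v w
  proof -
    have "x - y = d *\<^sub>R (w - v)" using eq by (simp add: algebra_simps)
    then have "dist x y = d * norm (w - v)" using d by (simp add: dist_norm)
    also have "\<dots> \<le> d * (2 * M)"
      using norm_triangle_ineq4[of w v] V[of v] V[of w] in_sets d by (intro mult_left_mono) auto
    also have "\<dots> < r" using d by (simp add: mult.commute)
    finally have "x = y" using sep in_sets by blast
    with eq d show ?thesis by simp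
  qed
  then show ?thesis by (auto simp: inj_on_def)
qed

section \<open>Double coverings from single coverings\<close>

text \<open>
  The two coverings have the same size: a single covering of the union of the clusters is
  contracted to a double covering of the centres.
\<close>

lemma double_covering_from_single_coverings:
  fixes S :: "(real ^ 'n::finite) set"
  assumes S: "S \<subseteq> rational_points" "finite S"
    and single: "\<And>S' :: (real ^ 'n) set. S' \<subseteq> rational_points \<Longrightarrow> finite S' \<Longrightarrow>
      card S' = (CARD('n) + 2) * card S \<Longrightarrow> \<exists>P. single_covering S' k P"
  shows "\<exists>Q. double_covering S k Q"
proof -
  obtain e where e: "e > 0"
    and sep_S: "\<And>T U a. T \<subseteq> S \<Longrightarrow> U \<subseteq> S \<Longrightarrow> almost_separates e a T U \<Longrightarrow>
      separated (convex hull T) (convex hull U)"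
    using uniform_separation_error[OF S(2)] by metis
  obtain r where r: "r > 0" "\<And>x y. x \<in> S \<Longrightarrow> y \<in> S \<Longrightarrow> dist x y < r \<Longrightarrow> x = y"
    using S(2) uniform_discrete_finite_iff[of S] unfolding uniform_discrete_def by metis
  obtain M where M: "M > 0" "\<And>v :: real ^ 'n. v \<in> cluster \<Longrightarrow> norm v \<le> M"
    using finite_imp_bounded[OF finite_cluster] unfolding bounded_pos by metis
  \<comment> \<open>Two displacements in clusters of scale \<open>d\<close> differ by at most \<open>2 * M * d\<close>.  This has to be
     less than \<open>r\<close>, so that the clusters are disjoint, and at most the error \<open>e\<close>.\<close>
  obtain d where d: "d \<in> \<rat>" "0 < d" "d < min e r / (2 * M)"
    using Rats_dense_in_real[of 0 "min e r / (2 * M)"] e r M by auto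
  have small: "2 * M * d < min e r" using d(3) M(1) by (simp add: field_simps)

  define S' where "S' = (\<lambda>(x, v). x + d *\<^sub>R v) ` (S \<times> cluster)"
  have "inj_on (\<lambda>(x, v). x + d *\<^sub>R v) (S \<times> cluster)"
    using small by (intro inj_on_small_translates[OF r(2) M(2) d(2)]) auto
  then have "card S' = (CARD('n) + 2) * card S"
    unfolding S'_def by (simp add: card_image card_cartesian_product card_cluster)
  moreover have "finite S'" using S(2) by (simp add: S'_def finite_cluster)
  moreover have "S' \<subseteq> rational_points"
    using S(1) cluster_rational d(1) unfolding S'_def rational_points_def
    by (fastforce intro!: Rats_add Rats_mult)
  ultimately obtain P where P: "single_covering S' k P" using single by blast
  have poly: "polyhedron (P i)" if "i < k" for i using P that by (simp add: fold_covering_def)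
  have cl: "convex (P i)" "closed (P i)" if "i < k" for i
    using poly[OF that] polyhedron_imp_convex polyhedron_imp_closed by auto
  have frontier_P: "frontier (P i) \<subseteq> P i" if "i < k" for i
    using cl(2)[OF that] by (rule frontier_subset_closed)
  have cover: "\<exists>i<k. x + d *\<^sub>R v \<in> frontier (P i)" if "x \<in> S" "v \<in> cluster" for x v
  proof -
    have "x + d *\<^sub>R v \<in> S'" using that by (auto simp: S'_def)
    then have "card {i. i < k \<and> x + d *\<^sub>R v \<in> frontier (P i)} \<ge> 1"
      using P unfolding fold_covering_def by blast
    then have "{i. i < k \<and> x + d *\<^sub>R v \<in> frontier (P i)} \<noteq> {}" by force
    then show ?thesis by blast
  qed

  define T where "T i = {x \<in> S. \<exists>v\<in>cluster. x + d *\<^sub>R v \<in> frontier (P i)}" for i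
  define Q where "Q i = convex hull (T i)" for i
  have T_sub: "T i \<subseteq> S" for i by (auto simp: T_def)
  have fin_T: "finite (T i)" for i using T_sub S(2) by (rule finite_subset)

  have sep_Q: "separated (Q i) (Q j)" if ij: "i < k" "j < k" "i \<noteq> j" for i j
  proof -
    from P ij have "separated (P i) (P j)" by (simp add: fold_covering_def)
    then obtain a b where a: "a \<noteq> 0"
      and Pi: "P i \<subseteq> {x. a \<bullet> x \<le> b}" and Pj: "P j \<subseteq> {x. a \<bullet> x \<ge> b}"
      unfolding separated_def by blast
    define u where "u = a /\<^sub>R norm a"
    have u: "norm u = 1" using a by (simp add: u_def)
    have "u \<bullet> x \<le> u \<bullet> y + e" if x: "x \<in> T i" and y: "y \<in> T j" for x y
    proof -
      from x obtain v where v: "v \<in> cluster" "x + d *\<^sub>R v \<in> P i"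
        using frontier_P ij by (auto simp: T_def)
      from y obtain w where w: "w \<in> cluster" "y + d *\<^sub>R w \<in> P j"
        using frontier_P ij by (auto simp: T_def)
      have "a \<bullet> (x + d *\<^sub>R v) \<le> a \<bullet> (y + d *\<^sub>R w)" using v w Pi Pj by fastforce
      then have "u \<bullet> (x + d *\<^sub>R v) \<le> u \<bullet> (y + d *\<^sub>R w)"
        using a by (simp add: u_def divide_right_mono mult_left_mono)
      then have "u \<bullet> x \<le> u \<bullet> y + d * (u \<bullet> (w - v))"
        by (simp add: inner_add_right inner_diff_right algebra_simps)
      moreover have "u \<bullet> (w - v) \<le> 2 * M"
        using norm_cauchy_schwarz[of u "w - v"] norm_triangle_ineq4[of w v] u
          M(2)[OF v(1)] M(2)[OF w(1)] by simp
      then have "d * (u \<bullet> (w - v)) \<le> d * (2 * M)" using d(2) by (intro mult_left_mono) auto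
      ultimately show ?thesis using small by (simp add: algebra_simps)
    qed
    then have "almost_separates e u (T i) (T j)" using u by (simp add: almost_separates_def)
    then show ?thesis unfolding Q_def using sep_S T_sub by blast
  qed

  have two: "card {i. i < k \<and> x \<in> frontier (Q i)} \<ge> 2" if x: "x \<in> S" for x
  proof -
    obtain i where i: "i < k" "x \<in> frontier (P i)"
      using cover[OF x zero_in_cluster] by auto
    obtain v where v: "v \<in> cluster" "x + d *\<^sub>R v \<notin> P i"
      using frontier_avoids_cluster_point[OF cl[OF i(1)] i(2) d(2)] by blast
    obtain j where j: "j < k" "x + d *\<^sub>R v \<in> frontier (P j)" using cover[OF x v(1)] by blast
    have "i \<noteq> j" using j(2) v(2) frontier_P[OF i(1)] by auto
    have "x \<in> T i" using i x zero_in_cluster by (force simp: T_def)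
    moreover have "x \<in> T j" using j x v by (auto simp: T_def)
    ultimately have "x \<in> Q i \<inter> Q j" by (simp add: Q_def hull_inc)
    then have "{i, j} \<subseteq> {i. i < k \<and> x \<in> frontier (Q i)}"
      using separated_Int_subset_frontier[OF sep_Q[OF i(1) j(1) \<open>i \<noteq> j\<close>]] i j by auto
    then have "card {i, j} \<le> card {i. i < k \<and> x \<in> frontier (Q i)}" by (intro card_mono) auto
    with \<open>i \<noteq> j\<close> show ?thesis by simp
  qed

  have "polytope (Q i)" for i
    unfolding Q_def using fin_T by (rule polytope_convex_hull)
  then have "polyhedron (Q i)" "bounded (Q i)" for i
    by (auto intro: polytope_imp_polyhedron polytope_imp_bounded)
  with sep_Q two have "double_covering S k Q" by (simp add: fold_covering_def)
  then show ?thesis by blast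
qed

theorem lemma19:
  fixes s :: nat
  shows "k1 ((CARD('n::finite) + 2) * s) TYPE('n) \<ge> k2 s TYPE('n)"
proof -
  have single: "\<exists>P. single_covering S (k1 ((CARD('n) + 2) * s) TYPE('n)) P"
    if "S \<subseteq> rational_points" "finite S" "card S = (CARD('n) + 2) * s" for S :: "(real ^ 'n) set"
    unfolding k1_def
    using LeastI_ex[OF covering_size_exists[of "(CARD('n) + 2) * s" 1]] that by blast
  show ?thesis
    unfolding k2_def
    using double_covering_from_single_coverings single by (intro Least_le) blast
qed

end
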